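(* Let $D\subsetneq\mathbb{R}^n$ be an open set with $\partial D\neq\emptyset$. For any $x\in D$ and $r\in(0,1)$, $$B_t(x,R_1)\subset B_{\tilde c}(x,r)\subset B_t(x,R_2),$$ where $R_1=\frac{r}{2+r}$ and $R_2=\frac{r}{2(1-r)}$. Moreover, $R_2/R_1\to 1$ as $r\to 0$.
   Context: $d(x)=d(x,\partial D)$ is the Euclidean distance from $x$ to the boundary $\partial D$ of $D$ in $\mathbb{R}^n$. For $x,y\in D$: $\tilde c_D(x,y)=\sup_{p\in\partial D}\frac{|x-y|}{\max\{|x-p|,|y-p|\}}$, and the $t$ metric is $t_D(x,y)=\frac{|x-y|}{|x-y|+d(x)+d(y)}$. Metric balls: $B_{\tilde c}(x,r)=\{y\in D:\tilde c_D(x,y)<r\}$ and $B_t(x,R)=\{y\in D:t_D(x,y)<R\}$. *)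

theory Defs
  imports "HOL-Analysis.Analysis"
begin

text \<open>Below, \<open>infdist x (frontier D)\<close> is the distance \<open>d(x)\<close> from \<open>x\<close> to the boundary.

  The supremum is taken in the reals. It is the true one for open \<open>D\<close> with nonempty boundary and
  \<open>x, y \<in> D\<close>: then \<open>x\<close> and \<open>y\<close> are not boundary points, so no denominator vanishes, and each
  quotient is at most 2 by the triangle inequality.\<close>

definition c_tilde :: "(real ^ 'n) set \<Rightarrow> real ^ 'n \<Rightarrow> real ^ 'n \<Rightarrow> real" where
  "c_tilde D x y = (SUP p\<in>frontier D. dist x y / max (dist x p) (dist y p))"

definition t_metric :: "(real ^ 'n) set \<Rightarrow> real ^ 'n \<Rightarrow> real ^ 'n \<Rightarrow> real" where
  "t_metric D x y =
     dist x y / (dist x y + infdist x (frontier D) + infdist y (frontier D))"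

definition c_tilde_ball :: "(real ^ 'n) set \<Rightarrow> real ^ 'n \<Rightarrow> real \<Rightarrow> (real ^ 'n) set" where
  "c_tilde_ball D x r = {y \<in> D. c_tilde D x y < r}"

definition t_ball :: "(real ^ 'n) set \<Rightarrow> real ^ 'n \<Rightarrow> real \<Rightarrow> (real ^ 'n) set" where
  "t_ball D x R = {y \<in> D. t_metric D x y < R}"

end

theory Submission
  imports Defs "HOL-Real_Asymp.Real_Asymp"
begin

text \<open>Every boundary point \<open>p\<close> satisfies
  \<open>max |x - p| |y - p| \<ge> max (d x) (d y) \<ge> (d x + d y) / 2\<close>, and a boundary point nearest to \<open>x\<close>
  satisfies \<open>max |x - p| |y - p| \<le> |x - y| + d x\<close>. Hence
  \<open>|x - y| / (|x - y| + min (d x) (d y)) \<le> c_tilde D x y \<le> 2 |x - y| / (d x + d y)\<close>,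
  and both inclusions reduce to algebra. The second one holds even with radius \<open>r / (2 - r)\<close>.\<close>

text \<open>The closed set \<open>frontier D\<close> misses the open set \<open>D\<close>. Strict
  positivity keeps the later denominators away from 0, where division would return 0.\<close>

lemma infdist_frontier_pos:
  assumes "open D" "frontier D \<noteq> {}" "x \<in> D"
  shows "0 < infdist x (frontier D)"
proof -
  have "x \<notin> frontier D"
    using assms by (simp add: frontier_def interior_open)
  then show ?thesis
    using assms(2) infdist_pos_not_in_closed[OF frontier_closed] by blast
qed

text \<open>The bound is independent of \<open>p\<close>, so it serves twice: it bounds the supremum
  from above, and it shows that the family of quotients is bounded.\<close>

lemma dist_quotient_le:
  assumes "open D" "p \<in> frontier D" "x \<in> D" "y \<in> D"
  shows "dist x y / max (dist x p) (dist y p)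
           \<le> 2 * dist x y / (infdist x (frontier D) + infdist y (frontier D))"
proof -
  have "frontier D \<noteq> {}"
    using assms(2) by blast
  note pos = infdist_frontier_pos[OF assms(1) this assms(3)]
    infdist_frontier_pos[OF assms(1) this assms(4)]
  have le: "(infdist x (frontier D) + infdist y (frontier D)) / 2 \<le> max (dist x p) (dist y p)"
    using infdist_le[OF assms(2), of x] infdist_le[OF assms(2), of y] by (auto simp: max_def)
  have "dist x y / max (dist x p) (dist y p)
      \<le> dist x y / ((infdist x (frontier D) + infdist y (frontier D)) / 2)"
    using pos le by (intro divide_left_mono mult_pos_pos) auto
  then show ?thesis
    by (simp add: mult.commute)
qed

lemma c_tilde_le:
  assumes "open D" "frontier D \<noteq> {}" "x \<in> D" "y \<in> D"
  shows "c_tilde D x y \<le> 2 * dist x y / (infdist x (frontier D) + infdist y (frontier D))"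
  unfolding c_tilde_def using assms by (intro cSUP_least dist_quotient_le)

lemma c_tilde_ge:
  assumes "open D" "frontier D \<noteq> {}" "x \<in> D" "y \<in> D"
  shows "dist x y / (dist x y + infdist x (frontier D)) \<le> c_tilde D x y"
proof -
  obtain p where p: "p \<in> frontier D" "infdist x (frontier D) = dist x p"
    using infdist_attains_inf[OF frontier_closed assms(2)] by metis
  have pos: "0 < dist x p"
    using infdist_frontier_pos[OF assms(1-3)] p(2) by simp
  have "dist y p \<le> dist x y + dist x p"
    by (metis dist_commute dist_triangle)
  then have "dist x y / (dist x y + dist x p) \<le> dist x y / max (dist x p) (dist y p)"
    using pos by (intro divide_left_mono mult_pos_pos) (auto simp: add_nonneg_pos less_max_iff_disj)
  \<comment> \<open>A real supremum dominates its members only if the family is bounded above;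
    \<open>dist_quotient_le\<close> supplies the bound.\<close>
  also have "\<dots> \<le> c_tilde D x y"
    unfolding c_tilde_def
    using assms p(1) by (intro cSUP_upper) (auto intro!: bdd_aboveI2 dist_quotient_le)
  finally show ?thesis
    using p(2) by simp
qed

text \<open>Transfers \<open>c_tilde_ge\<close>, which involves only the distance from
  \<open>x\<close> to the boundary, to the distance from \<open>y\<close>.\<close>

lemma c_tilde_commute: "c_tilde D x y = c_tilde D y x"
  by (simp add: c_tilde_def dist_commute max.commute)

lemma t_ball_subset_c_tilde_ball:
  assumes "open D" "frontier D \<noteq> {}" "x \<in> D" "0 < r"
  shows "t_ball D x (r / (2 + r)) \<subseteq> c_tilde_ball D x r"
proof
  fix y assume "y \<in> t_ball D x (r / (2 + r))"
  then have y: "y \<in> D" and t: "t_metric D x y < r / (2 + r)"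
    by (auto simp: t_ball_def)
  let ?d = "dist x y" and ?s = "infdist x (frontier D) + infdist y (frontier D)"
  have pos: "0 < ?s"
    using assms y by (intro add_pos_pos infdist_frontier_pos)
  then have "?d / (?d + ?s) < r / (2 + r)" "0 < ?d + ?s"
    using t by (auto simp: t_metric_def add.assoc add_nonneg_pos)
  \<comment> \<open>Cross-multiplying gives \<open>?d * (2 + r) < r * (?d + ?s)\<close>, and
    \<open>r * ?d\<close> cancels. So \<open>r / (2 + r)\<close> is exactly the threshold for
    \<open>t_metric\<close> at which the upper bound \<open>2 * ?d / ?s\<close> equals
    \<open>r\<close>.\<close>
  then have "2 * ?d < r * ?s"
    using \<open>0 < r\<close> by (simp add: divide_simps) (simp add: algebra_simps)
  then have "2 * ?d / ?s < r"
    using pos by (simp add: pos_divide_less_eq)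
  then show "y \<in> c_tilde_ball D x r"
    using c_tilde_le[OF assms(1-3) y] y by (simp add: c_tilde_ball_def)
qed

lemma c_tilde_ball_subset_t_ball:
  assumes "open D" "frontier D \<noteq> {}" "x \<in> D" "0 < r" "r < 1"
  shows "c_tilde_ball D x r \<subseteq> t_ball D x (r / (2 - r))"
proof
  fix y assume "y \<in> c_tilde_ball D x r"
  then have y: "y \<in> D" and c: "c_tilde D x y < r"
    by (auto simp: c_tilde_ball_def)
  let ?d = "dist x y" and ?a = "infdist x (frontier D)" and ?b = "infdist y (frontier D)"
  have pos: "0 < ?a" "0 < ?b"
    using infdist_frontier_pos assms y by auto
  have sum_pos: "0 < ?d + ?a" "0 < ?d + ?b" "0 < ?d + ?a + ?b"
    using pos by (auto simp: add_nonneg_pos add_pos_pos)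
  have "?d / (?d + ?a) < r"
    using c_tilde_ge[OF assms(1-3) y] c by linarith
  moreover have "?d / (?d + ?b) < r"
    using c_tilde_ge[OF assms(1,2) y assms(3)] c
    by (simp add: dist_commute c_tilde_commute)
  ultimately have "?d < r * (?d + ?a)" "?d < r * (?d + ?b)"
    using sum_pos by (simp_all add: pos_divide_less_eq)
  \<comment> \<open>The sum of the two inequalities is
    \<open>2 * ?d < r * (2 * ?d + ?a + ?b)\<close>; one \<open>r * ?d\<close> moves to the
    left.\<close>
  then have "?d * (2 - r) < r * (?d + ?a + ?b)"
    by (simp add: algebra_simps)
  then have "?d / (?d + ?a + ?b) < r / (2 - r)"
    using sum_pos \<open>r < 1\<close> by (simp add: divide_simps)
  then show "y \<in> t_ball D x (r / (2 - r))"
    using y by (simp add: t_ball_def t_metric_def)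
qed

theorem theorem8:
  fixes D :: "(real ^ 'n) set" and R\<^sub>1 R\<^sub>2 :: "real \<Rightarrow> real"
  defines "R\<^sub>1 \<equiv> \<lambda>r. r / (2 + r)"
    and "R\<^sub>2 \<equiv> \<lambda>r. r / (2 * (1 - r))"
  assumes "open D" and "D \<noteq> UNIV" and "frontier D \<noteq> {}"
  shows "(\<forall>x\<in>D. \<forall>r\<in>{0<..<1}.
            t_ball D x (R\<^sub>1 r) \<subseteq> c_tilde_ball D x r \<and>
            c_tilde_ball D x r \<subseteq> t_ball D x (R\<^sub>2 r)) \<and>
         ((\<lambda>r. R\<^sub>2 r / R\<^sub>1 r) \<longlongrightarrow> 1) (at_right 0)"
proof (intro conjI ballI)
  fix x r assume x: "x \<in> D" and "r \<in> {0<..<1::real}"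
  then have r: "0 < r" "r < 1"
    by auto
  show "t_ball D x (R\<^sub>1 r) \<subseteq> c_tilde_ball D x r"
    unfolding R\<^sub>1_def using t_ball_subset_c_tilde_ball assms x r by blast
  \<comment> \<open>The denominators compare as \<open>2 * (1 - r) = 2 - 2 * r \<le> 2 - r\<close>,
    and both are positive since \<open>r < 1\<close>.\<close>
  have "r / (2 - r) \<le> R\<^sub>2 r"
    unfolding R\<^sub>2_def using r by (intro divide_left_mono mult_pos_pos) auto
  then have "t_ball D x (r / (2 - r)) \<subseteq> t_ball D x (R\<^sub>2 r)"
    by (auto simp: t_ball_def)
  then show "c_tilde_ball D x r \<subseteq> t_ball D x (R\<^sub>2 r)"
    using c_tilde_ball_subset_t_ball[OF assms(3,5) x r] by blast
next
  \<comment> \<open>For \<open>0 < r < 1\<close> the quotient is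
    \<open>(2 + r) / (2 * (1 - r))\<close>.\<close>
  show "((\<lambda>r. R\<^sub>2 r / R\<^sub>1 r) \<longlongrightarrow> 1) (at_right 0)"
    unfolding R\<^sub>1_def R\<^sub>2_def by real_asymp
qed

end
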